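(* Let $(\mathbb{X},\mathbb{R}^{d_{\mathbb X}})$ and $(\mathbb{Y},\mathbb{R}^{d_{\mathbb Y}})$ be topological dynamical systems and let $(\mathbb{X}\times\mathbb{Y},\mathbb{R}^{d_{\mathbb X}+d_{\mathbb Y}})$ be their direct product dynamical system. Assume that both factors have a well-defined, finite orbit separation dimension and that, for both factors, the limit in the definition of the $\mathrm{OSD}$ exists (that is, for every $\delta>0$ the $\limsup$ as $\nu\searrow0$ is a limit). Then $$\mathrm{OSD}(\mathbb{X}\times\mathbb{Y},\mathbb{R}^{d_{\mathbb X}}\times\mathbb{R}^{d_{\mathbb Y}})=\mathrm{OSD}(\mathbb{X},\mathbb{R}^{d_{\mathbb X}})+\mathrm{OSD}(\mathbb{Y},\mathbb{R}^{d_{\mathbb Y}}).$$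
   Context: A topological dynamical system $(\mathbb{X},G)$ consists of a compact metric space $(\mathbb{X},d)$ and a continuous action of $G$ by homeomorphisms, written $x\mapsto x+t$; here $G=\mathbb{R}^{n}$ with Lebesgue measure $|\cdot|$. A Følner sequence in $G$ is a sequence $\{F_n\}$ of non-empty compact sets with $|(F_n+g)\triangle F_n|/|F_n|\to0$ for all $g\in G$; one is fixed for each system. For $\delta>0$ and $x,y\in\mathbb{X}$, let $D_\delta(x,y)=\limsup_n|\{t\in G:d(x+t,y+t)\ge\delta\}\cap F_n|/|F_n|$. A set $S\subseteq\mathbb{X}$ is $(\delta,\nu)$-separated if $D_\delta(x,y)\ge\nu$ for all distinct $x,y\in S$, and $\mathrm{Sep}(\mathbb{X},\delta,\nu)$ is the maximal cardinality of a $(\delta,\nu)$-separated subset of $\mathbb{X}$. The orbit separation dimension is $$\mathrm{OSD}(\mathbb{X},G)=\sup_{\delta>0}\limsup_{\nu\searrow0}\frac{\log\mathrm{Sep}(\mathbb{X},\delta,\nu)}{-\log\nu}.$$ The product space $\mathbb{X}\times\mathbb{Y}$ carries the sup metric of the two individual metrics, $\mathbb{R}^{d_{\mathbb X}}\times\mathbb{R}^{d_{\mathbb Y}}$ acts componentwise by $(x,y)+(s,t)=(x+s,y+t)$, and the $\mathrm{OSD}$ of the product system is computed with respect to the product $\{F_n\times F'_n\}$ of the Følner sequences used for the two factors. *)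

theory Defs
  imports "HOL-Analysis.Analysis" "HOL-Library.Extended_Nat"
begin

text \<open>
  The phase space is a carrier set with an explicit metric rather than a type of class
  \<open>metric_space\<close>, since the class instance for products is the Euclidean product metric and not
  the sup metric. The acting group \<open>\<real>\<^sup>n\<close> is an arbitrary Euclidean space, so that
  \<open>'g \<times> 'h\<close> can act on a product. The term \<open>act x t\<close> stands for the translate \<open>x + t\<close>.
\<close>

locale top_dyn_sys = Metric_space X d
  for X :: "'a set" and d :: "'a \<Rightarrow> 'a \<Rightarrow> real" +
  fixes act :: "'a \<Rightarrow> 'g::euclidean_space \<Rightarrow> 'a"
  assumes compact: "compact_space mtopology"
    and act_continuous:
      "continuous_map (prod_topology mtopology euclidean) mtopology (\<lambda>(x, t). act x t)"
    and act_zero: "\<And>x. x \<in> X \<Longrightarrow> act x 0 = x"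
    and act_add: "\<And>x s t. x \<in> X \<Longrightarrow> act x (s + t) = act (act x s) t"

text \<open>
  Positivity of \<open>|F n|\<close> is implicit in the usual definition, which divides by it; it has to be
  explicit here because \<open>x / 0 = 0\<close>.
\<close>

definition Folner_sequence :: "(nat \<Rightarrow> 'g::euclidean_space set) \<Rightarrow> bool" where
  "Folner_sequence F \<longleftrightarrow>
     (\<forall>n. F n \<noteq> {} \<and> compact (F n) \<and> 0 < measure lebesgue (F n)) \<and>
     (\<forall>g. (\<lambda>n. measure lebesgue (sym_diff ((\<lambda>t. t + g) ` F n) (F n))
                 / measure lebesgue (F n)) \<longlonglongrightarrow> 0)"

definition sep_density ::
    "('a \<Rightarrow> 'a \<Rightarrow> real) \<Rightarrow> ('a \<Rightarrow> 'g::euclidean_space \<Rightarrow> 'a) \<Rightarrow> (nat \<Rightarrow> 'g set) \<Rightarrow> real \<Rightarrow> 'a \<Rightarrow> 'a \<Rightarrow> ereal"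
  where
  "sep_density d act F \<delta> x y =
     limsup (\<lambda>n. ereal (measure lebesgue ({t. \<delta> \<le> d (act x t) (act y t)} \<inter> F n)
                          / measure lebesgue (F n)))"

definition separated ::
    "'a set \<Rightarrow> ('a \<Rightarrow> 'a \<Rightarrow> real) \<Rightarrow> ('a \<Rightarrow> 'g::euclidean_space \<Rightarrow> 'a) \<Rightarrow> (nat \<Rightarrow> 'g set) \<Rightarrow> real \<Rightarrow> real
       \<Rightarrow> 'a set \<Rightarrow> bool"
  where
  "separated X d act F \<delta> \<nu> S \<longleftrightarrow>
     S \<subseteq> X \<and> (\<forall>x\<in>S. \<forall>y\<in>S. x \<noteq> y \<longrightarrow> ereal \<nu> \<le> sep_density d act F \<delta> x y)"

definition ecard :: "'a set \<Rightarrow> enat" where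
  "ecard S = (if finite S then enat (card S) else \<infinity>)"

definition Sep ::
    "'a set \<Rightarrow> ('a \<Rightarrow> 'a \<Rightarrow> real) \<Rightarrow> ('a \<Rightarrow> 'g::euclidean_space \<Rightarrow> 'a) \<Rightarrow> (nat \<Rightarrow> 'g set) \<Rightarrow> real \<Rightarrow> real
       \<Rightarrow> enat"
  where
  "Sep X d act F \<delta> \<nu> = (SUP S \<in> {S. separated X d act F \<delta> \<nu> S}. ecard S)"

text \<open>
  The value \<open>-\<infinity>\<close> at \<open>0\<close> only matters for the empty phase space, whose orbit separation
  dimension is then \<open>-\<infinity>\<close>.
\<close>

definition log_enat :: "enat \<Rightarrow> ereal" where
  "log_enat k = (case k of enat n \<Rightarrow> if n = 0 then - \<infinity> else ereal (ln (real n)) | \<infinity> \<Rightarrow> \<infinity>)"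

definition OSD_quotient ::
    "'a set \<Rightarrow> ('a \<Rightarrow> 'a \<Rightarrow> real) \<Rightarrow> ('a \<Rightarrow> 'g::euclidean_space \<Rightarrow> 'a) \<Rightarrow> (nat \<Rightarrow> 'g set) \<Rightarrow> real \<Rightarrow> real
       \<Rightarrow> ereal"
  where
  "OSD_quotient X d act F \<delta> \<nu> = log_enat (Sep X d act F \<delta> \<nu>) / ereal (- ln \<nu>)"

definition OSD ::
    "'a set \<Rightarrow> ('a \<Rightarrow> 'a \<Rightarrow> real) \<Rightarrow> ('a \<Rightarrow> 'g::euclidean_space \<Rightarrow> 'a) \<Rightarrow> (nat \<Rightarrow> 'g set) \<Rightarrow> ereal"
  where
  "OSD X d act F = (SUP \<delta>\<in>{0<..}. Limsup (at_right 0) (OSD_quotient X d act F \<delta>))"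

definition OSD_limit_exists ::
    "'a set \<Rightarrow> ('a \<Rightarrow> 'a \<Rightarrow> real) \<Rightarrow> ('a \<Rightarrow> 'g::euclidean_space \<Rightarrow> 'a) \<Rightarrow> (nat \<Rightarrow> 'g set) \<Rightarrow> bool"
  where
  "OSD_limit_exists X d act F \<longleftrightarrow>
     (\<forall>\<delta>>0. \<exists>l. (OSD_quotient X d act F \<delta> \<longlongrightarrow> l) (at_right 0))"

definition sup_metric ::
    "('a \<Rightarrow> 'a \<Rightarrow> real) \<Rightarrow> ('b \<Rightarrow> 'b \<Rightarrow> real) \<Rightarrow> 'a \<times> 'b \<Rightarrow> 'a \<times> 'b \<Rightarrow> real" where
  "sup_metric d d' p q = max (d (fst p) (fst q)) (d' (snd p) (snd q))"

definition prod_act ::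
    "('a \<Rightarrow> 'g \<Rightarrow> 'a) \<Rightarrow> ('b \<Rightarrow> 'h \<Rightarrow> 'b) \<Rightarrow> 'a \<times> 'b \<Rightarrow> 'g \<times> 'h \<Rightarrow> 'a \<times> 'b" where
  "prod_act act act' p u = (act (fst p) (fst u), act' (snd p) (snd u))"

end

theory Submission
  imports Defs
begin

text \<open>
  In the product, the separation set of two pairs meets \<open>F n \<times> F' n\<close> in the complement of a product
  of complements, so its relative measure is \<open>a + b - a b\<close> for the relative measures \<open>a\<close>, \<open>b\<close> in the
  factors. Hence the density of the product lies between the maximum and the sum of the densities of
  the factors. The maximum makes products of separated sets separated, which gives
  \<open>Sep \<delta> \<nu> \<ge> Sep\<^sub>X \<delta> \<nu> * Sep\<^sub>Y \<delta> \<nu>\<close>; the sum, together with the fact that maximal separated sets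
  are spanning, gives \<open>Sep \<delta> \<nu> \<le> Sep\<^sub>X (\<delta>/2) (\<nu>/4) * Sep\<^sub>Y (\<delta>/2) (\<nu>/4)\<close>.
\<close>

section \<open>Separation densities\<close>

text \<open>The real-valued sequence whose \<open>limsup\<close> is the density. Pointwise
  inequalities and the exact product formula hold at each \<open>n\<close>, before any limit is
  taken.\<close>

definition sep_ratio ::
    "('a \<Rightarrow> 'a \<Rightarrow> real) \<Rightarrow> ('a \<Rightarrow> 'g::euclidean_space \<Rightarrow> 'a) \<Rightarrow> (nat \<Rightarrow> 'g set) \<Rightarrow> real \<Rightarrow> 'a \<Rightarrow> 'a \<Rightarrow> nat \<Rightarrow> real"
  where
  "sep_ratio d act F \<delta> x y n =
     measure lebesgue ({t. \<delta> \<le> d (act x t) (act y t)} \<inter> F n) / measure lebesgue (F n)"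

lemma sep_density_eq: "sep_density d act F \<delta> x y = limsup (\<lambda>n. ereal (sep_ratio d act F \<delta> x y n))"
  by (simp add: sep_density_def sep_ratio_def)

lemma Folner_sequence_compact: "Folner_sequence F \<Longrightarrow> compact (F n)"
  and Folner_sequence_pos: "Folner_sequence F \<Longrightarrow> 0 < measure lebesgue (F n)"
  by (auto simp: Folner_sequence_def)

section \<open>Measurability and the triangle inequality in a single system\<close>

context top_dyn_sys
begin

lemma act_in: "x \<in> X \<Longrightarrow> act x t \<in> X"
  using act_continuous by (auto simp: continuous_map_def Pi_iff)

lemma continuous_map_act: "x \<in> X \<Longrightarrow> continuous_map euclidean mtopology (act x)"
  using continuous_map_compose[OF _ act_continuous, of euclidean "\<lambda>t. (x, t)"]
  by (simp add: o_def continuous_map_paired)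

text \<open>The distance of the two orbits is a continuous function of \<open>t\<close>. Closedness
  makes the intersection with each compact \<open>F n\<close> compact, hence of finite measure and
  measurable, as every comparison of measures below requires.\<close>

lemma closed_sep_set:
  assumes "x \<in> X" "y \<in> X"
  shows "closed {t. \<delta> \<le> d (act x t) (act y t)}"
proof -
  have "continuous_map euclidean euclideanreal
          (\<lambda>t. mdist (metric (X, d)) (act x t) (act y t))"
    using assms by (intro continuous_map_mdist) (auto simp: mtopology_of_def continuous_map_act)
  then have "continuous_on UNIV (\<lambda>t. d (act x t) (act y t))"
    by simp
  then show ?thesis
    by (intro closed_Collect_le continuous_intros) auto
qed

lemma compact_sep_set:
  assumes "Folner_sequence F" "x \<in> X" "y \<in> X"
  shows "compact ({t. \<delta> \<le> d (act x t) (act y t)} \<inter> F n)"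
  using closed_Int_compact closed_sep_set assms Folner_sequence_compact by metis

lemma sep_ratio_nonneg: "0 \<le> sep_ratio d act F \<delta> x y n"
  by (simp add: sep_ratio_def)

lemma sep_ratio_le_1:
  assumes "Folner_sequence F" "x \<in> X" "y \<in> X"
  shows "sep_ratio d act F \<delta> x y n \<le> 1"
  using assms measure_mono_fmeasurable[of "{t. \<delta> \<le> d (act x t) (act y t)} \<inter> F n" "F n" lebesgue]
    compact_sep_set[OF assms] Folner_sequence_compact[OF assms(1)] Folner_sequence_pos[OF assms(1), of n]
  by (simp add: sep_ratio_def fmeasurableD lmeasurable_compact)

lemma sep_density_commute:
  assumes "x \<in> X" "y \<in> X"
  shows "sep_density d act F \<delta> x y = sep_density d act F \<delta> y x"
  using assms by (simp add: sep_density_def commute)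

lemma sep_density_same:
  assumes "x \<in> X" "0 < \<delta>"
  shows "sep_density d act F \<delta> x x = 0"
proof -
  have "{t. \<delta> \<le> d (act x t) (act x t)} = {}"
    using assms act_in by simp
  then show ?thesis
    by (simp add: sep_density_def Limsup_const zero_ereal_def)
qed

text \<open>At a time when \<open>x\<close> and \<open>z\<close> are at distance at least
  \<open>\<delta> + \<delta>'\<close>, the point \<open>y\<close> cannot be closer than
  \<open>\<delta>\<close> to \<open>x\<close> and closer than \<open>\<delta>'\<close> to
  \<open>z\<close>. So one separation set lies in the union of the other two, and measure is
  subadditive.\<close>

lemma sep_ratio_triangle:
  assumes F: "Folner_sequence F" and xyz: "x \<in> X" "y \<in> X" "z \<in> X"
  shows "sep_ratio d act F (\<delta> + \<delta>') x z n \<le> sep_ratio d act F \<delta> x y n + sep_ratio d act F \<delta>' y z n"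
proof -
  let ?A = "\<lambda>\<delta> x y. {t. \<delta> \<le> d (act x t) (act y t)} \<inter> F n"
  note c = compact_sep_set[OF F]
  have "?A (\<delta> + \<delta>') x z \<subseteq> ?A \<delta> x y \<union> ?A \<delta>' y z"
  proof
    fix t assume t: "t \<in> ?A (\<delta> + \<delta>') x z"
    have "d (act x t) (act z t) \<le> d (act x t) (act y t) + d (act y t) (act z t)"
      using xyz act_in by (intro triangle) auto
    then show "t \<in> ?A \<delta> x y \<union> ?A \<delta>' y z"
      using t by auto
  qed
  then have "measure lebesgue (?A (\<delta> + \<delta>') x z) \<le> measure lebesgue (?A \<delta> x y \<union> ?A \<delta>' y z)"
    using c xyz by (intro measure_mono_fmeasurable) (auto intro!: fmeasurableD lmeasurable_compact)
  also have "\<dots> \<le> measure lebesgue (?A \<delta> x y) + measure lebesgue (?A \<delta>' y z)"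
    using c xyz by (intro measure_Un_le) (auto intro!: fmeasurableD lmeasurable_compact)
  finally show ?thesis
    unfolding sep_ratio_def using Folner_sequence_pos[OF F, of n]
    by (simp add: divide_right_mono flip: add_divide_distrib)
qed

lemma sep_density_triangle:
  assumes "Folner_sequence F" "x \<in> X" "y \<in> X" "z \<in> X"
  shows "sep_density d act F (\<delta> + \<delta>') x z \<le> sep_density d act F \<delta> x y + sep_density d act F \<delta>' y z"
proof -
  have "sep_density d act F (\<delta> + \<delta>') x z
          \<le> limsup (\<lambda>n. ereal (sep_ratio d act F \<delta> x y n) + ereal (sep_ratio d act F \<delta>' y z n))"
    unfolding sep_density_eq using sep_ratio_triangle[OF assms] by (intro Limsup_mono) simp
  also have "\<dots> \<le> sep_density d act F \<delta> x y + sep_density d act F \<delta>' y z"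
    unfolding sep_density_eq by (rule ereal_limsup_add_mono)
  finally show ?thesis .
qed

lemma sep_density_antimono:
  assumes F: "Folner_sequence F" and xy: "x \<in> X" "y \<in> X" and "\<delta>' \<le> \<delta>"
  shows "sep_density d act F \<delta> x y \<le> sep_density d act F \<delta>' x y"
proof -
  have "sep_ratio d act F \<delta> x y n \<le> sep_ratio d act F \<delta>' x y n" for n
    unfolding sep_ratio_def
    using compact_sep_set[OF F xy] \<open>\<delta>' \<le> \<delta>\<close>
    by (intro divide_right_mono measure_mono_fmeasurable)
      (auto intro!: fmeasurableD lmeasurable_compact)
  then show ?thesis
    unfolding sep_density_eq by (intro Limsup_mono) simp
qed

end

section \<open>Densities in the product system\<close>

lemma measure_lebesgue_Times_compact:
  fixes A :: "'g::euclidean_space set" and B :: "'h::euclidean_space set"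
  assumes "compact A" "compact B"
  shows "measure lebesgue (A \<times> B) = measure lebesgue A * measure lebesgue B"
proof -
  have A: "A \<in> sets lborel" and B: "B \<in> sets lborel" and AB: "A \<times> B \<in> sets lborel"
    using assms by (auto intro!: compact_Times borel_compact)
  have "emeasure (lborel :: ('g \<times> 'h) measure) (A \<times> B) = emeasure lborel A * emeasure lborel B"
    using lborel.emeasure_pair_measure_Times[OF A B] by (simp add: lborel_prod)
  then show ?thesis
    using A B AB by (simp add: measure_completion measure_def enn2real_mult)
qed

text \<open>A maximum reaches \<open>\<delta>\<close> iff one of its two entries does, so the
  separation set inside \<open>F n \<times> F' n\<close> is
  \<open>A \<times> F' n \<union> F n \<times> B\<close>. These two pieces meet in
  \<open>A \<times> B\<close>, and inclusion-exclusion gives the formula.\<close>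

lemma sep_ratio_prod:
  assumes X: "top_dyn_sys X dX actX" and F: "Folner_sequence F"
    and Y: "top_dyn_sys Y dY actY" and F': "Folner_sequence F'"
    and "x \<in> X" "x' \<in> X" "y \<in> Y" "y' \<in> Y"
  shows "sep_ratio (sup_metric dX dY) (prod_act actX actY) (\<lambda>n. F n \<times> F' n) \<delta> (x, y) (x', y') n
           = sep_ratio dX actX F \<delta> x x' n + sep_ratio dY actY F' \<delta> y y' n
             - sep_ratio dX actX F \<delta> x x' n * sep_ratio dY actY F' \<delta> y y' n"
proof -
  define A where "A = {t. \<delta> \<le> dX (actX x t) (actX x' t)} \<inter> F n"
  define B where "B = {t. \<delta> \<le> dY (actY y t) (actY y' t)} \<inter> F' n"
  have c: "compact A" "compact B" "compact (F n)" "compact (F' n)"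
    using assms by (auto simp: A_def B_def Folner_sequence_compact top_dyn_sys.compact_sep_set)
  have eq: "{u. \<delta> \<le> sup_metric dX dY (prod_act actX actY (x, y) u) (prod_act actX actY (x', y') u)}
              \<inter> (F n \<times> F' n) = A \<times> F' n \<union> F n \<times> B"
    by (auto simp: A_def B_def sup_metric_def prod_act_def le_max_iff_disj)
  have int: "(A \<times> F' n) \<inter> (F n \<times> B) = A \<times> B"
    by (auto simp: A_def B_def)
  have fm: "A \<times> F' n \<in> lmeasurable" "F n \<times> B \<in> lmeasurable"
    using c by (auto intro!: lmeasurable_compact compact_Times)
  have "measure lebesgue (A \<times> F' n \<union> F n \<times> B)
          = measure lebesgue (A \<times> F' n) + measure lebesgue (F n \<times> B) - measure lebesgue (A \<times> B)"
    using measure_Un3[OF fm] by (simp add: int)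
  then have "sep_ratio (sup_metric dX dY) (prod_act actX actY) (\<lambda>n. F n \<times> F' n) \<delta> (x, y) (x', y') n
     = (measure lebesgue A * measure lebesgue (F' n) + measure lebesgue (F n) * measure lebesgue B
          - measure lebesgue A * measure lebesgue B)
        / (measure lebesgue (F n) * measure lebesgue (F' n))"
    unfolding sep_ratio_def by (simp add: eq c measure_lebesgue_Times_compact)
  also have "\<dots> = measure lebesgue A / measure lebesgue (F n) + measure lebesgue B / measure lebesgue (F' n)
      - (measure lebesgue A / measure lebesgue (F n)) * (measure lebesgue B / measure lebesgue (F' n))"
    using Folner_sequence_pos[OF F, of n] Folner_sequence_pos[OF F', of n]
    by (simp add: field_simps)
  finally show ?thesis
    by (simp add: A_def B_def sep_ratio_def)
qed

text \<open>In \<open>a + b - a b\<close> the subtracted product is nonnegative and is dropped; the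
  rest is subadditivity of \<open>limsup\<close>.\<close>

lemma sep_density_prod_le:
  assumes "top_dyn_sys X dX actX" "Folner_sequence F" "top_dyn_sys Y dY actY" "Folner_sequence F'"
    and "x \<in> X" "x' \<in> X" "y \<in> Y" "y' \<in> Y"
  shows "sep_density (sup_metric dX dY) (prod_act actX actY) (\<lambda>n. F n \<times> F' n) \<delta> (x, y) (x', y')
           \<le> sep_density dX actX F \<delta> x x' + sep_density dY actY F' \<delta> y y'"
proof -
  have "sep_density (sup_metric dX dY) (prod_act actX actY) (\<lambda>n. F n \<times> F' n) \<delta> (x, y) (x', y')
          \<le> limsup (\<lambda>n. ereal (sep_ratio dX actX F \<delta> x x' n) + ereal (sep_ratio dY actY F' \<delta> y y' n))"
    unfolding sep_density_eq using assms
    by (intro Limsup_mono) (simp add: sep_ratio_prod top_dyn_sys.sep_ratio_nonneg)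
  also have "\<dots> \<le> sep_density dX actX F \<delta> x x' + sep_density dY actY F' \<delta> y y'"
    unfolding sep_density_eq by (rule ereal_limsup_add_mono)
  finally show ?thesis .
qed

text \<open>Both ratios lie in [0, 1], so \<open>a b\<close> is at most \<open>a\<close> and at most
  \<open>b\<close>; hence \<open>a + b - a b\<close> is at least each of them.\<close>

lemma sep_density_prod_ge:
  assumes X: "top_dyn_sys X dX actX" and F: "Folner_sequence F"
    and Y: "top_dyn_sys Y dY actY" and F': "Folner_sequence F'"
    and xy: "x \<in> X" "x' \<in> X" "y \<in> Y" "y' \<in> Y"
  shows "sep_density dX actX F \<delta> x x'
      \<le> sep_density (sup_metric dX dY) (prod_act actX actY) (\<lambda>n. F n \<times> F' n) \<delta> (x, y) (x', y')" (is ?X)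
    and "sep_density dY actY F' \<delta> y y'
      \<le> sep_density (sup_metric dX dY) (prod_act actX actY) (\<lambda>n. F n \<times> F' n) \<delta> (x, y) (x', y')" (is ?Y)
proof -
  let ?a = "sep_ratio dX actX F \<delta> x x'" and ?b = "sep_ratio dY actY F' \<delta> y y'"
  have ab: "0 \<le> ?a n" "?a n \<le> 1" "0 \<le> ?b n" "?b n \<le> 1" for n
    using assms by (auto simp: top_dyn_sys.sep_ratio_nonneg top_dyn_sys.sep_ratio_le_1)
  have "?a n * ?b n \<le> ?a n" "?a n * ?b n \<le> ?b n" for n
    using ab[of n] by (simp_all add: mult_left_le mult_left_le_one_le)
  then have le: "?a n \<le> ?a n + ?b n - ?a n * ?b n" "?b n \<le> ?a n + ?b n - ?a n * ?b n" for n
    by (simp_all add: algebra_simps)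
  show ?X ?Y
    unfolding sep_density_eq sep_ratio_prod[OF X F Y F' xy]
    using le by (auto intro!: Limsup_mono)
qed

section \<open>Separation numbers\<close>

lemma ecard_enat: "ecard S = enat n \<longleftrightarrow> finite S \<and> card S = n"
  by (simp add: ecard_def)

lemma Sep_upper: "separated X d act F \<delta> \<nu> S \<Longrightarrow> ecard S \<le> Sep X d act F \<delta> \<nu>"
  unfolding Sep_def by (rule SUP_upper) simp

lemma separated_card_le:
  assumes "separated X d act F \<delta> \<nu> S" "Sep X d act F \<delta> \<nu> = enat m"
  shows "finite S" "card S \<le> m"
  using Sep_upper[OF assms(1)] by (auto simp: assms(2) ecard_def split: if_splits)

text \<open>A finite supremum bounds the cardinalities, so only finitely many values occur and the
  supremum is a maximum. The empty set is separated, so there is at least one value.\<close>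

lemma Sep_attained:
  assumes "Sep X d act F \<delta> \<nu> = enat m"
  obtains S where "separated X d act F \<delta> \<nu> S" "finite S" "card S = m"
proof -
  let ?E = "ecard ` {S. separated X d act F \<delta> \<nu> S}"
  have "separated X d act F \<delta> \<nu> {}"
    by (simp add: separated_def)
  then have ne: "?E \<noteq> {}" by blast
  have "finite ?E"
    using assms by (intro finite_enat_bounded[of _ m]) (auto dest: Sep_upper)
  then have "Sup ?E \<in> ?E"
    using ne by (simp add: Sup_enat_def Max_in)
  then obtain S where "separated X d act F \<delta> \<nu> S" "ecard S = Sep X d act F \<delta> \<nu>"
    by (auto simp: Sep_def)
  then show ?thesis
    using assms that by (simp add: ecard_enat)
qed

text \<open>A singleton is vacuously separated. This keeps nonempty systems away from the value
  \<open>-\<infinity>\<close> of \<open>log_enat\<close> at 0.\<close>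

lemma Sep_ge_1:
  assumes "x \<in> X"
  shows "1 \<le> Sep X d act F \<delta> \<nu>"
proof -
  have "separated X d act F \<delta> \<nu> {x}"
    using assms by (simp add: separated_def)
  from Sep_upper[OF this] show ?thesis
    by (simp add: ecard_def one_enat_def)
qed

lemma (in top_dyn_sys) Sep_antimono:
  assumes "Folner_sequence F" "\<delta>' \<le> \<delta>"
  shows "Sep X d act F \<delta> \<nu> \<le> Sep X d act F \<delta>' \<nu>"
  unfolding Sep_def
proof (rule SUP_subset_mono)
  show "{S. separated X d act F \<delta> \<nu> S} \<subseteq> {S. separated X d act F \<delta>' \<nu> S}"
    unfolding separated_def using sep_density_antimono[OF assms(1) _ _ assms(2)]
    by (blast intro: order_trans)
qed simp

text \<open>A point far from every element of a separated set of maximal cardinality could be added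
  to it, giving a separated set with \<open>m + 1\<close> elements.\<close>

lemma (in top_dyn_sys) maximal_separated_spanning:
  assumes "0 < \<delta>" "0 < \<nu>" and Sep: "Sep X d act F \<delta> \<nu> = enat m"
  obtains S where "S \<subseteq> X" "finite S" "card S = m"
    "\<And>x. x \<in> X \<Longrightarrow> \<exists>s\<in>S. sep_density d act F \<delta> x s < ereal \<nu>"
proof -
  obtain S where S: "separated X d act F \<delta> \<nu> S" "finite S" "card S = m"
    using Sep_attained[OF Sep] .
  have "\<exists>s\<in>S. sep_density d act F \<delta> x s < ereal \<nu>" if x: "x \<in> X" for x
  proof (rule ccontr)
    assume far: "\<not> (\<exists>s\<in>S. sep_density d act F \<delta> x s < ereal \<nu>)"
    \<comment> \<open>If \<open>x\<close> were in \<open>S\<close>, it would be its own near point,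
      since its density to itself is 0, which is below \<open>\<nu>\<close>.\<close>
    then have "x \<notin> S"
      using sep_density_same[OF x \<open>0 < \<delta>\<close>] \<open>0 < \<nu>\<close> by force
    have "ereal \<nu> \<le> sep_density d act F \<delta> x s" "ereal \<nu> \<le> sep_density d act F \<delta> s x" if "s \<in> S" for s
      using that far S(1) sep_density_commute[OF x, of s F \<delta>]
      by (auto simp: not_less separated_def subset_iff)
    then have "separated X d act F \<delta> \<nu> (insert x S)"
      using S(1) x unfolding separated_def by auto
    from separated_card_le(2)[OF this Sep] show False
      using S \<open>x \<notin> S\<close> by simp
  qed
  then show ?thesis
    using S that by (auto simp: separated_def)
qed

section \<open>Separation numbers of the product\<close>

text \<open>Two distinct pairs in \<open>S \<times> T\<close> differ in some coordinate, are
  separated there, and the product density dominates the density of that coordinate.\<close>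

lemma Sep_prod_ge:
  assumes X: "top_dyn_sys X dX actX" and F: "Folner_sequence F"
    and Y: "top_dyn_sys Y dY actY" and F': "Folner_sequence F'"
    and SX: "Sep X dX actX F \<delta> \<nu> = enat m" and SY: "Sep Y dY actY F' \<delta> \<nu> = enat k"
  shows "enat (m * k) \<le> Sep (X \<times> Y) (sup_metric dX dY) (prod_act actX actY) (\<lambda>n. F n \<times> F' n) \<delta> \<nu>"
proof -
  obtain S where S: "separated X dX actX F \<delta> \<nu> S" "finite S" "card S = m"
    using Sep_attained[OF SX] .
  obtain T where T: "separated Y dY actY F' \<delta> \<nu> T" "finite T" "card T = k"
    using Sep_attained[OF SY] .
  have "ereal \<nu> \<le> sep_density (sup_metric dX dY) (prod_act actX actY) (\<lambda>n. F n \<times> F' n) \<delta> (x, y) (x', y')"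
    if "x \<in> S" "x' \<in> S" "y \<in> T" "y' \<in> T" "(x, y) \<noteq> (x', y')" for x x' y y'
  proof -
    have xy: "x \<in> X" "x' \<in> X" "y \<in> Y" "y' \<in> Y"
      using that S(1) T(1) by (auto simp: separated_def)
    have "ereal \<nu> \<le> sep_density dX actX F \<delta> x x' \<or> ereal \<nu> \<le> sep_density dY actY F' \<delta> y y'"
      using that S(1) T(1) by (auto simp: separated_def)
    then show ?thesis
      using sep_density_prod_ge[OF X F Y F' xy] order_trans by blast
  qed
  then have "separated (X \<times> Y) (sup_metric dX dY) (prod_act actX actY) (\<lambda>n. F n \<times> F' n) \<delta> \<nu> (S \<times> T)"
    using S(1) T(1) unfolding separated_def by auto
  from Sep_upper[OF this] show ?thesis
    using S T by (simp add: ecard_def card_cartesian_product)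
qed

text \<open>Pigeonhole: each coordinate is sent to a near centre in a spanning set. The triangle
  inequality through a common centre doubles \<open>\<delta>/2\<close> to \<open>\<delta>\<close>
  and \<open>\<nu>/4\<close> to \<open>\<nu>/2\<close>, and adding the two factors gives
  \<open>\<nu>\<close>. So separated pairs never share both centres.\<close>

lemma Sep_prod_le:
  assumes X: "top_dyn_sys X dX actX" and F: "Folner_sequence F"
    and Y: "top_dyn_sys Y dY actY" and F': "Folner_sequence F'"
    and "0 < \<delta>" "0 < \<nu>"
    and SX: "Sep X dX actX F (\<delta>/2) (\<nu>/4) = enat m" and SY: "Sep Y dY actY F' (\<delta>/2) (\<nu>/4) = enat k"
  shows "Sep (X \<times> Y) (sup_metric dX dY) (prod_act actX actY) (\<lambda>n. F n \<times> F' n) \<delta> \<nu> \<le> enat (m * k)"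
  unfolding Sep_def
proof (rule SUP_least)
  fix P assume "P \<in> {P. separated (X \<times> Y) (sup_metric dX dY) (prod_act actX actY) (\<lambda>n. F n \<times> F' n) \<delta> \<nu> P}"
  then have P: "P \<subseteq> X \<times> Y"
    and sep: "\<And>p q. p \<in> P \<Longrightarrow> q \<in> P \<Longrightarrow> p \<noteq> q \<Longrightarrow>
      ereal \<nu> \<le> sep_density (sup_metric dX dY) (prod_act actX actY) (\<lambda>n. F n \<times> F' n) \<delta> p q"
    by (auto simp: separated_def)
  have pos: "0 < \<delta>/2" "0 < \<nu>/4" using \<open>0 < \<delta>\<close> \<open>0 < \<nu>\<close> by auto
  obtain S where S: "S \<subseteq> X" "finite S" "card S = m"
      and "\<And>x. x \<in> X \<Longrightarrow> \<exists>s\<in>S. sep_density dX actX F (\<delta>/2) x s < ereal (\<nu>/4)"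
    using top_dyn_sys.maximal_separated_spanning[OF X pos SX] by blast
  then obtain f where f: "\<And>x. x \<in> X \<Longrightarrow> f x \<in> S \<and> sep_density dX actX F (\<delta>/2) x (f x) < ereal (\<nu>/4)"
    by metis
  obtain T where T: "T \<subseteq> Y" "finite T" "card T = k"
      and "\<And>y. y \<in> Y \<Longrightarrow> \<exists>t\<in>T. sep_density dY actY F' (\<delta>/2) y t < ereal (\<nu>/4)"
    using top_dyn_sys.maximal_separated_spanning[OF Y pos SY] by blast
  then obtain g where g: "\<And>y. y \<in> Y \<Longrightarrow> g y \<in> T \<and> sep_density dY actY F' (\<delta>/2) y (g y) < ereal (\<nu>/4)"
    by metis
  have close_X: "sep_density dX actX F \<delta> x x' < ereal (\<nu>/2)"
    if "x \<in> X" "x' \<in> X" "f x = f x'" for x x'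
  proof -
    have "f x \<in> X" using that f S by auto
    then have "sep_density dX actX F \<delta> x x'
        \<le> sep_density dX actX F (\<delta>/2) x (f x) + sep_density dX actX F (\<delta>/2) x' (f x')"
      using top_dyn_sys.sep_density_triangle[OF X F, of x "f x" x' "\<delta>/2" "\<delta>/2"]
        top_dyn_sys.sep_density_commute[OF X, of "f x" x'] that by simp
    also have "\<dots> < ereal (\<nu>/4) + ereal (\<nu>/4)"
      using f[OF that(1)] f[OF that(2)] by (intro ereal_add_strict_mono2) auto
    finally show ?thesis by simp
  qed
  have close_Y: "sep_density dY actY F' \<delta> y y' < ereal (\<nu>/2)"
    if "y \<in> Y" "y' \<in> Y" "g y = g y'" for y y'
  proof -
    have "g y \<in> Y" using that g T by auto
    then have "sep_density dY actY F' \<delta> y y'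
        \<le> sep_density dY actY F' (\<delta>/2) y (g y) + sep_density dY actY F' (\<delta>/2) y' (g y')"
      using top_dyn_sys.sep_density_triangle[OF Y F', of y "g y" y' "\<delta>/2" "\<delta>/2"]
        top_dyn_sys.sep_density_commute[OF Y, of "g y" y'] that by simp
    also have "\<dots> < ereal (\<nu>/4) + ereal (\<nu>/4)"
      using g[OF that(1)] g[OF that(2)] by (intro ereal_add_strict_mono2) auto
    finally show ?thesis by simp
  qed
  \<comment> \<open>Two distinct points of \<open>P\<close> with the same pair of centres would have
    density strictly below \<open>\<nu>/2 + \<nu>/2\<close>, against separation.\<close>
  have inj: "inj_on (map_prod f g) P"
  proof (rule inj_onI, rule ccontr)
    fix p q assume pq: "p \<in> P" "q \<in> P" "map_prod f g p = map_prod f g q" "p \<noteq> q"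
    obtain x y x' y' where xy: "p = (x, y)" "q = (x', y')" by fastforce
    have m: "x \<in> X" "x' \<in> X" "y \<in> Y" "y' \<in> Y" "f x = f x'" "g y = g y'"
      using pq P xy by auto
    have "ereal \<nu> \<le> sep_density dX actX F \<delta> x x' + sep_density dY actY F' \<delta> y y'"
      using sep[OF pq(1,2,4)] sep_density_prod_le[OF X F Y F' m(1-4)] order_trans xy by blast
    also have "\<dots> < ereal (\<nu>/2) + ereal (\<nu>/2)"
      using close_X[OF m(1,2,5)] close_Y[OF m(3,4,6)] by (rule ereal_add_strict_mono2)
    finally show False by simp
  qed
  have "map_prod f g ` P \<subseteq> S \<times> T"
    using P f g by auto
  then have "finite P" "card P \<le> card (S \<times> T)"
    using inj S T inj_on_finite[OF inj, of "S \<times> T"] card_inj_on_le[OF inj, of "S \<times> T"] by auto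
  then show "ecard P \<le> enat (m * k)"
    using S T by (simp add: ecard_def card_cartesian_product)
qed

section \<open>Growth rates\<close>

lemma Sep_finite_cases:
  assumes "x \<in> X" "Sep X d act F \<delta> \<nu> \<noteq> \<infinity>"
  obtains m where "1 \<le> m" "Sep X d act F \<delta> \<nu> = enat m"
  using assms Sep_ge_1[OF assms(1), of d act F \<delta> \<nu>]
  by (cases "Sep X d act F \<delta> \<nu>") (auto simp: one_enat_def)

lemma OSD_quotient_enat:
  assumes "Sep X d act F \<delta> \<nu> = enat m" "1 \<le> m" "0 < \<nu>" "\<nu> < 1"
  shows "OSD_quotient X d act F \<delta> \<nu> = ereal (ln (real m) / - ln \<nu>)"
  using assms by (simp add: OSD_quotient_def log_enat_def)

text \<open>For \<open>\<nu>\<close> in (0, 1) the denominator is a positive real, so an infinite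
  separation number would make the quotient infinite. A finite upper bound therefore also yields
  finiteness.\<close>

lemma OSD_quotient_lessD:
  assumes "x \<in> X" "0 < \<nu>" "\<nu> < 1" "OSD_quotient X d act F \<delta> \<nu> < ereal c"
  obtains m where "1 \<le> m" "Sep X d act F \<delta> \<nu> = enat m" "ln (real m) < c * - ln \<nu>"
proof -
  have "Sep X d act F \<delta> \<nu> \<noteq> \<infinity>"
  proof
    assume "Sep X d act F \<delta> \<nu> = \<infinity>"
    with assms show False
      by (simp add: OSD_quotient_def log_enat_def)
  qed
  then obtain m where m: "1 \<le> m" "Sep X d act F \<delta> \<nu> = enat m"
    using Sep_finite_cases assms(1) by metis
  have "0 < - ln \<nu>" using assms by simp
  then have "ln (real m) < c * - ln \<nu>"
    using assms(4) unfolding OSD_quotient_enat[OF m(2,1) assms(2,3)]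
    by (simp only: less_ereal.simps pos_divide_less_eq)
  with m that show ?thesis by blast
qed

lemma OSD_quotient_antimono:
  assumes "top_dyn_sys X d act" "Folner_sequence F" "\<delta>' \<le> \<delta>" "x \<in> X" "0 < \<nu>" "\<nu> < 1"
  shows "OSD_quotient X d act F \<delta> \<nu> \<le> OSD_quotient X d act F \<delta>' \<nu>"
proof (cases "Sep X d act F \<delta>' \<nu> = \<infinity>")
  case True
  then show ?thesis
    using assms by (simp add: OSD_quotient_def log_enat_def)
next
  case False
  then obtain m where m: "1 \<le> m" "Sep X d act F \<delta>' \<nu> = enat m"
    using Sep_finite_cases assms(4) by metis
  have le: "Sep X d act F \<delta> \<nu> \<le> enat m"
    using top_dyn_sys.Sep_antimono[OF assms(1-3)] m by metis
  then have "Sep X d act F \<delta> \<nu> \<noteq> \<infinity>"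
    using enat_ile by auto
  then obtain k where k: "1 \<le> k" "Sep X d act F \<delta> \<nu> = enat k"
    using Sep_finite_cases assms(4) by metis
  with le have "k \<le> m" by simp
  then have "ln (real k) / - ln \<nu> \<le> ln (real m) / - ln \<nu>"
    using k assms by (intro divide_right_mono) auto
  then show ?thesis
    unfolding OSD_quotient_enat[OF m(2,1) assms(5,6)] OSD_quotient_enat[OF k(2,1) assms(5,6)]
    by simp
qed

lemma eventually_at_right_unit: "eventually (\<lambda>\<nu>::real. 0 < \<nu> \<and> \<nu> < 1) (at_right 0)"
  by (auto simp: eventually_at_right_field intro!: exI[of _ 1])

lemma eventually_OSD_quotient_less:
  assumes "OSD X d act F < ereal c" "0 < \<delta>"
  shows "eventually (\<lambda>\<nu>. OSD_quotient X d act F \<delta> \<nu> < ereal c) (at_right 0)"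
proof -
  have "Limsup (at_right 0) (OSD_quotient X d act F \<delta>) \<le> OSD X d act F"
    unfolding OSD_def using \<open>0 < \<delta>\<close> by (intro SUP_upper) auto
  then show ?thesis
    using assms by (intro Limsup_lessD) auto
qed

text \<open>This is where existence of the limit enters. A lower bound on a \<open>Limsup\<close>
  alone gives only arbitrarily small good \<open>\<nu>\<close>, which may differ between the
  factors; a lower bound on a limit holds for all small \<open>\<nu>\<close>, so both factors can
  share one \<open>\<nu>\<close>.\<close>

lemma eventually_less_OSD_quotient:
  assumes "OSD_limit_exists X d act F" "ereal c < OSD X d act F"
  obtains \<delta> where "0 < \<delta>"
    "eventually (\<lambda>\<nu>. ereal c < OSD_quotient X d act F \<delta> \<nu>) (at_right 0)"
proof -
  obtain \<delta> where \<delta>: "0 < \<delta>" "ereal c < Limsup (at_right 0) (OSD_quotient X d act F \<delta>)"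
    using assms(2) by (auto simp: OSD_def less_SUP_iff)
  obtain l where l: "(OSD_quotient X d act F \<delta> \<longlongrightarrow> l) (at_right 0)"
    using assms(1) \<delta> unfolding OSD_limit_exists_def by blast
  then have "Limsup (at_right 0) (OSD_quotient X d act F \<delta>) = l"
    by (intro lim_imp_Limsup) auto
  with \<delta> l have "eventually (\<lambda>\<nu>. ereal c < OSD_quotient X d act F \<delta> \<nu>) (at_right 0)"
    by (auto intro: order_tendstoD(1))
  with \<delta> that show ?thesis by blast
qed

text \<open>Serves to show that a system with finite dimension has a point. In the empty space only
  the empty set is separated, so the logarithm is \<open>-\<infinity>\<close> at every
  scale.\<close>

lemma OSD_empty: "OSD {} d act F = - \<infinity>"
proof -
  have "Sep {} d act F \<delta> \<nu> = 0" for \<delta> \<nu>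
    by (simp add: Sep_def separated_def ecard_def enat_0)
  then have "OSD_quotient {} d act F \<delta> \<nu> = - \<infinity>" if "0 < \<nu>" "\<nu> < 1" for \<delta> \<nu>
    using that by (simp add: OSD_quotient_def log_enat_def zero_enat_def)
  then have "Limsup (at_right 0) (OSD_quotient {} d act F \<delta>) \<le> - \<infinity>" for \<delta>
    by (intro Limsup_bounded eventually_mono[OF eventually_at_right_unit]) auto
  then show ?thesis
    by (simp add: OSD_def)
qed

section \<open>The two inequalities for the dimension of the product\<close>

text \<open>Upper bounds on the factors' \<open>Limsup\<close> hold eventually, hence at a common
  scale \<open>\<nu>/4\<close>. Passing from \<open>\<nu>/4\<close> to \<open>\<nu>\<close> costs
  only an additive constant in the logarithm, negligible against \<open>- ln \<nu>\<close>.\<close>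

lemma OSD_prod_le:
  assumes X: "top_dyn_sys X dX actX" and F: "Folner_sequence F"
    and Y: "top_dyn_sys Y dY actY" and F': "Folner_sequence F'"
    and OX: "OSD X dX actX F = ereal L" and OY: "OSD Y dY actY F' = ereal M"
  shows "OSD (X \<times> Y) (sup_metric dX dY) (prod_act actX actY) (\<lambda>n. F n \<times> F' n) \<le> ereal (L + M)"
  unfolding OSD_def
proof (rule SUP_least)
  fix \<delta> :: real assume "\<delta> \<in> {0<..}"
  then have "0 < \<delta>" by simp
  let ?Q = "OSD_quotient (X \<times> Y) (sup_metric dX dY) (prod_act actX actY) (\<lambda>n. F n \<times> F' n) \<delta>"
  obtain x y where x: "x \<in> X" and y: "y \<in> Y"
    using OX OY OSD_empty by (metis MInfty_neq_ereal(2) ex_in_conv)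
  show "Limsup (at_right 0) ?Q \<le> ereal (L + M)"
  proof (rule ereal_le_epsilon2)
    fix e :: real assume "0 < e"
    \<comment> \<open>The constant left over when \<open>- ln (\<nu>/4)\<close> is expanded as
      \<open>- ln \<nu> + ln 4\<close>. The margin \<open>e\<close> is split in three: one third for
      each factor and one to absorb \<open>K\<close>.\<close>
    define K where "K = (L + M + 2 * (e/3)) * ln 4"
    have quarter: "filterlim (\<lambda>\<nu>::real. \<nu>/4) (at_right 0) (at_right 0)"
      by (auto simp: filterlim_at intro!: tendsto_eq_intros eventually_mono[OF eventually_at_right_unit])
    have "eventually (\<lambda>\<nu>. OSD_quotient X dX actX F (\<delta>/2) (\<nu>/4) < ereal (L + e/3)) (at_right 0)"
      using OX \<open>0 < \<delta>\<close> \<open>0 < e\<close>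
      by (intro eventually_compose_filterlim[OF _ quarter] eventually_OSD_quotient_less) auto
    moreover have "eventually (\<lambda>\<nu>. OSD_quotient Y dY actY F' (\<delta>/2) (\<nu>/4) < ereal (M + e/3)) (at_right 0)"
      using OY \<open>0 < \<delta>\<close> \<open>0 < e\<close>
      by (intro eventually_compose_filterlim[OF _ quarter] eventually_OSD_quotient_less) auto
    \<comment> \<open>For such \<open>\<nu>\<close> the constant \<open>K\<close> is at most
      \<open>(e/3) * - ln \<nu>\<close>.\<close>
    moreover have "eventually (\<lambda>\<nu>::real. ln \<nu> \<le> - (K / (e/3))) (at_right 0)"
      using ln_at_0 by (auto simp: filterlim_at_bot)
    ultimately have "eventually (\<lambda>\<nu>. ?Q \<nu> \<le> ereal (L + M + e)) (at_right 0)"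
      using eventually_at_right_unit
    proof eventually_elim
      case (elim \<nu>)
      then have \<nu>: "0 < \<nu>" "\<nu> < 1" "0 < \<nu>/4" "\<nu>/4 < 1" by auto
      obtain m where m: "1 \<le> m" "Sep X dX actX F (\<delta>/2) (\<nu>/4) = enat m"
          "ln (real m) < (L + e/3) * - ln (\<nu>/4)"
        using OSD_quotient_lessD[OF x \<nu>(3,4) elim(1)] .
      obtain k where k: "1 \<le> k" "Sep Y dY actY F' (\<delta>/2) (\<nu>/4) = enat k"
          "ln (real k) < (M + e/3) * - ln (\<nu>/4)"
        using OSD_quotient_lessD[OF y \<nu>(3,4) elim(2)] .
      have le: "Sep (X \<times> Y) (sup_metric dX dY) (prod_act actX actY) (\<lambda>n. F n \<times> F' n) \<delta> \<nu> \<le> enat (m * k)"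
        using Sep_prod_le[OF X F Y F' \<open>0 < \<delta>\<close> \<nu>(1) m(2) k(2)] .
      have xy: "(x, y) \<in> X \<times> Y" using x y by simp
      from le have "Sep (X \<times> Y) (sup_metric dX dY) (prod_act actX actY) (\<lambda>n. F n \<times> F' n) \<delta> \<nu> \<noteq> \<infinity>"
        using enat_ile by auto
      then obtain j where j: "1 \<le> j"
          "Sep (X \<times> Y) (sup_metric dX dY) (prod_act actX actY) (\<lambda>n. F n \<times> F' n) \<delta> \<nu> = enat j"
        using Sep_finite_cases[OF xy] by metis
      with le have "j \<le> m * k" by simp
      then have "real j \<le> real m * real k" by (metis of_nat_le_iff of_nat_mult)
      then have "ln (real j) \<le> ln (real m * real k)"
        using j m k by simp
      also have "\<dots> = ln (real m) + ln (real k)"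
        using m k by (simp add: ln_mult)
      also have "\<dots> \<le> (L + M + 2 * (e/3)) * - ln (\<nu>/4)"
        using m k by (simp add: algebra_simps)
      also have "\<dots> = (L + M + 2 * (e/3)) * - ln \<nu> + K"
        using \<nu> by (simp add: K_def ln_div field_simps)
      also have "\<dots> \<le> (L + M + 2 * (e/3)) * - ln \<nu> + (e/3) * - ln \<nu>"
        using elim(3) \<open>0 < e\<close> by (simp add: field_simps)
      also have "\<dots> = (L + M + e) * - ln \<nu>"
        by (simp add: algebra_simps)
      finally have "ln (real j) / - ln \<nu> \<le> L + M + e"
        using \<nu> by (subst pos_divide_le_eq) auto
      then show ?case
        unfolding OSD_quotient_enat[OF j(2,1) \<nu>(1,2)] by simp
    qed
    then show "Limsup (at_right 0) ?Q \<le> ereal (L + M) + ereal e"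
      by (intro Limsup_bounded) simp
  qed
qed

text \<open>Each factor nearly attains its supremum at some \<open>\<delta>\<close>. Decreasing
  \<open>\<delta>\<close> only raises the quotients, so the smaller of the two values works for
  both, and products of separated sets add the logarithms.\<close>

lemma OSD_prod_ge:
  assumes X: "top_dyn_sys X dX actX" and F: "Folner_sequence F"
    and Y: "top_dyn_sys Y dY actY" and F': "Folner_sequence F'"
    and OX: "OSD X dX actX F = ereal L" and OY: "OSD Y dY actY F' = ereal M"
    and limX: "OSD_limit_exists X dX actX F" and limY: "OSD_limit_exists Y dY actY F'"
  shows "ereal (L + M) \<le> OSD (X \<times> Y) (sup_metric dX dY) (prod_act actX actY) (\<lambda>n. F n \<times> F' n)"
    (is "_ \<le> ?O")
proof (rule ereal_le_epsilon2)
  fix e :: real assume "0 < e"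
  obtain x y where x: "x \<in> X" and y: "y \<in> Y"
    using OX OY OSD_empty by (metis MInfty_neq_ereal(2) ex_in_conv)
  obtain \<delta>1 where \<delta>1: "0 < \<delta>1"
      "eventually (\<lambda>\<nu>. ereal (L - e/2) < OSD_quotient X dX actX F \<delta>1 \<nu>) (at_right 0)"
    using eventually_less_OSD_quotient[OF limX, of "L - e/2"] OX \<open>0 < e\<close> by auto
  obtain \<delta>2 where \<delta>2: "0 < \<delta>2"
      "eventually (\<lambda>\<nu>. ereal (M - e/2) < OSD_quotient Y dY actY F' \<delta>2 \<nu>) (at_right 0)"
    using eventually_less_OSD_quotient[OF limY, of "M - e/2"] OY \<open>0 < e\<close> by auto
  define \<delta> where "\<delta> = min \<delta>1 \<delta>2"
  have \<delta>: "0 < \<delta>" "\<delta> \<le> \<delta>1" "\<delta> \<le> \<delta>2" using \<delta>1 \<delta>2 by (auto simp: \<delta>_def)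
  let ?Q = "OSD_quotient (X \<times> Y) (sup_metric dX dY) (prod_act actX actY) (\<lambda>n. F n \<times> F' n) \<delta>"
  \<comment> \<open>The bounds \<open>L + 1\<close> and \<open>M + 1\<close> serve only to make the
    factors' separation numbers finite; any reals above \<open>L\<close> and \<open>M\<close> would
    do.\<close>
  have "eventually (\<lambda>\<nu>. OSD_quotient X dX actX F \<delta> \<nu> < ereal (L + 1)) (at_right 0)"
    using OX \<delta> by (intro eventually_OSD_quotient_less) auto
  moreover have "eventually (\<lambda>\<nu>. OSD_quotient Y dY actY F' \<delta> \<nu> < ereal (M + 1)) (at_right 0)"
    using OY \<delta> by (intro eventually_OSD_quotient_less) auto
  ultimately have "eventually (\<lambda>\<nu>. ereal (L + M - e) \<le> ?Q \<nu>) (at_right 0)"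
    using \<delta>1(2) \<delta>2(2) eventually_at_right_unit
  proof eventually_elim
    case (elim \<nu>)
    then have \<nu>: "0 < \<nu>" "\<nu> < 1" by auto
    obtain m where m: "1 \<le> m" "Sep X dX actX F \<delta> \<nu> = enat m"
      using OSD_quotient_lessD[OF x \<nu> elim(1)] by metis
    obtain k where k: "1 \<le> k" "Sep Y dY actY F' \<delta> \<nu> = enat k"
      using OSD_quotient_lessD[OF y \<nu> elim(2)] by metis
    have qm: "L - e/2 < ln (real m) / - ln \<nu>"
      using elim(3) OSD_quotient_antimono[OF X F \<delta>(2) x \<nu>] OSD_quotient_enat[OF m(2,1) \<nu>]
      by (metis less_ereal.simps(1) less_le_trans)
    have qk: "M - e/2 < ln (real k) / - ln \<nu>"
      using elim(4) OSD_quotient_antimono[OF Y F' \<delta>(3) y \<nu>] OSD_quotient_enat[OF k(2,1) \<nu>]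
      by (metis less_ereal.simps(1) less_le_trans)
    have sum: "L + M - e \<le> (ln (real m) + ln (real k)) / - ln \<nu>"
      using qm qk unfolding add_divide_distrib by linarith
    have ge: "enat (m * k) \<le> Sep (X \<times> Y) (sup_metric dX dY) (prod_act actX actY) (\<lambda>n. F n \<times> F' n) \<delta> \<nu>"
      using Sep_prod_ge[OF X F Y F' m(2) k(2)] .
    show ?case
    \<comment> \<open>An infinite separation number of the product makes its quotient
      \<open>\<infinity>\<close>, and the bound is then trivial.\<close>
    proof (cases "Sep (X \<times> Y) (sup_metric dX dY) (prod_act actX actY) (\<lambda>n. F n \<times> F' n) \<delta> \<nu>")
      case infinity
      then show ?thesis
        using \<nu> by (simp add: OSD_quotient_def log_enat_def)
    next
      case (enat j)
      with ge have "m * k \<le> j" by simp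
      moreover have "1 \<le> m * k" using m(1) k(1) by simp
      ultimately have j: "1 \<le> j" "real m * real k \<le> real j"
        by (linarith, metis \<open>m * k \<le> j\<close> of_nat_le_iff of_nat_mult)
      have "ln (real m) + ln (real k) = ln (real m * real k)"
        using m k by (simp add: ln_mult)
      also have "\<dots> \<le> ln (real j)"
        using j m k by simp
      finally have "(ln (real m) + ln (real k)) / - ln \<nu> \<le> ln (real j) / - ln \<nu>"
        using \<nu> by (intro divide_right_mono) auto
      with sum show ?thesis
        unfolding OSD_quotient_enat[OF enat j(1) \<nu>] by (simp only: ereal_less_eq)
    qed
  qed
  then have "ereal (L + M - e) \<le> Limsup (at_right 0) ?Q"
    by (intro le_Limsup) auto
  also have "\<dots> \<le> ?O"
    unfolding OSD_def using \<delta> by (intro SUP_upper) auto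
  finally show "ereal (L + M) \<le> ?O + ereal e"
    by (cases ?O) auto
qed

theorem theorem5p2:
  fixes X :: "'a set" and dX :: "'a \<Rightarrow> 'a \<Rightarrow> real"
    and actX :: "'a \<Rightarrow> real ^ 'n \<Rightarrow> 'a" and F :: "nat \<Rightarrow> (real ^ 'n) set"
    and Y :: "'b set" and dY :: "'b \<Rightarrow> 'b \<Rightarrow> real"
    and actY :: "'b \<Rightarrow> real ^ 'm \<Rightarrow> 'b" and F' :: "nat \<Rightarrow> (real ^ 'm) set"
  assumes "top_dyn_sys X dX actX" and "Folner_sequence F"
    and "top_dyn_sys Y dY actY" and "Folner_sequence F'"
    and "\<bar>OSD X dX actX F\<bar> \<noteq> \<infinity>" and "\<bar>OSD Y dY actY F'\<bar> \<noteq> \<infinity>"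
    and "OSD_limit_exists X dX actX F" and "OSD_limit_exists Y dY actY F'"
  shows "OSD (X \<times> Y) (sup_metric dX dY) (prod_act actX actY) (\<lambda>n. F n \<times> F' n)
           = OSD X dX actX F + OSD Y dY actY F'"
proof -
  obtain L M where L: "OSD X dX actX F = ereal L" and M: "OSD Y dY actY F' = ereal M"
    using assms(5,6) by auto
  show ?thesis
    using OSD_prod_le[OF assms(1-4) L M] OSD_prod_ge[OF assms(1-4) L M assms(7,8)]
    by (simp add: L M)
qed

end
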